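(* Let $r\ge1$ and $n\geq 4r^2$ be integers. Then $\mathcal{G}(\mathrm{S}_{n,r})\leq \frac{2n}{r}+1$.
   Context: $\mathrm{S}_{n,r}$ denotes $\mathrm{S}_n$ acting naturally on the set of $r$-subsets of $[n]=\{1,\dots,n\}$. For a finite permutation group $G$ on $\Omega$, the greedy algorithm builds $\beta_1,\beta_2,\dots$ where each $\beta_i$ lies in a largest orbit of the pointwise stabiliser of $\{\beta_1,\dots,\beta_{i-1}\}$, stopping when this stabiliser is trivial; $\mathcal{G}(G)$ is the maximum number of points chosen, over all possible choices. *)

theory Defs
  imports Complex_Main "HOL-Combinatorics.Permutations"
begin

text \<open>A permutation group is given by a set G of group elements, an action
  act and the finite set Omega on which it acts.\<close>

definition pw_stab :: "'g set \<Rightarrow> ('g \<Rightarrow> 'a \<Rightarrow> 'a) \<Rightarrow> 'a set \<Rightarrow> 'g set" where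
  "pw_stab G act B = {g \<in> G. \<forall>b\<in>B. act g b = b}"

definition orbit_of :: "'g set \<Rightarrow> ('g \<Rightarrow> 'a \<Rightarrow> 'a) \<Rightarrow> 'a \<Rightarrow> 'a set" where
  "orbit_of H act x = (\<lambda>h. act h x) ` H"

definition acts_trivially :: "'g set \<Rightarrow> ('g \<Rightarrow> 'a \<Rightarrow> 'a) \<Rightarrow> 'a set \<Rightarrow> bool" where
  "acts_trivially H act Omega \<longleftrightarrow> (\<forall>h\<in>H. \<forall>x\<in>Omega. act h x = x)"

definition in_largest_orbit :: "'g set \<Rightarrow> ('g \<Rightarrow> 'a \<Rightarrow> 'a) \<Rightarrow> 'a set \<Rightarrow> 'a \<Rightarrow> bool" where
  "in_largest_orbit H act Omega x \<longleftrightarrow>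
     x \<in> Omega \<and> (\<forall>y\<in>Omega. card (orbit_of H act y) \<le> card (orbit_of H act x))"

definition greedy_seq :: "'g set \<Rightarrow> ('g \<Rightarrow> 'a \<Rightarrow> 'a) \<Rightarrow> 'a set \<Rightarrow> 'a list \<Rightarrow> bool" where
  "greedy_seq G act Omega bs \<longleftrightarrow>
     (\<forall>i < length bs.
        \<not> acts_trivially (pw_stab G act (set (take i bs))) act Omega \<and>
        in_largest_orbit (pw_stab G act (set (take i bs))) act Omega (bs ! i)) \<and>
     acts_trivially (pw_stab G act (set bs)) act Omega"

definition greedy_number :: "'g set \<Rightarrow> ('g \<Rightarrow> 'a \<Rightarrow> 'a) \<Rightarrow> 'a set \<Rightarrow> nat" where
  "greedy_number G act Omega = Max {length bs | bs. greedy_seq G act Omega bs}"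

definition Sym :: "nat \<Rightarrow> (nat \<Rightarrow> nat) set" where
  "Sym n = {\<sigma>. \<sigma> permutes {1..n}}"

definition subset_action :: "(nat \<Rightarrow> nat) \<Rightarrow> nat set \<Rightarrow> nat set" where
  "subset_action \<sigma> A = \<sigma> ` A"

definition r_subsets :: "nat \<Rightarrow> nat \<Rightarrow> nat set set" where
  "r_subsets n r = {A. A \<subseteq> {1..n} \<and> card A = r}"

end

theory Submission
  imports Defs
begin

text \<open>
  The stabiliser of the chosen sets is the Young subgroup of the partition of [n] into the atoms
  they generate: the cell R of points not yet chosen, and the other cells, collected in Q.
  Double counting the swaps of a point of the chosen set A in a cell S with a point outside A in a
  cell P shows that a largest orbit satisfies |P - A| |S \<inter> A| \<le> (|S - A| + 1) (|P \<inter> A| + 1).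

  Each step picks r points. Picks from R number at most n in total, since a point leaves R once. If a
  step takes at most one point from each other cell, and never all of it, then every pick outside R
  creates a new cell, and there are at most n cells. So steps of this kind number at most 2n/r in
  total, and the slack in this count pays for the at most two steps which are not.

  As n \<ge> 4r^2, the first 3r sets are disjoint. Call them, and what later remains of them, the main
  cells. From then on the main cells have sizes M or M - 1 for some M. They are so numerous that M
  takes at least three steps to drop by one. Once a main cell is touched, R shrinks fast enough to
  have at most M^2 + 1 points, so no cell outside R ever exceeds M + 1. This makes every step
  economical until M = 1, when the partition is almost discrete.
\<close>

section \<open>Cells of the stabiliser and their refinement\<close>

text \<open>The rest \<open>R\<close> is kept apart from \<open>Q\<close>: what \<open>A\<close>
  cuts from it becomes an ordinary cell, and \<open>R - A\<close> is the new rest. Empty parts are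
  removed because \<open>card Q\<close> has to count genuine cells.\<close>

definition refine :: "'a set \<Rightarrow> 'a set set \<Rightarrow> 'a set \<Rightarrow> 'a set set" where
  "refine A Q R = ((\<lambda>P. P \<inter> A) ` Q \<union> (\<lambda>P. P - A) ` Q \<union> {R \<inter> A}) - {{}}"

text \<open>The Young subgroup is described by the two properties that orbit counting uses: cells
  are invariant, and transpositions inside a cell are available. \<open>R\<close> may be empty, so
  only \<open>Q\<close> excludes the empty set.\<close>

definition cell_partition ::
  "nat \<Rightarrow> (nat \<Rightarrow> nat) set \<Rightarrow> nat set set \<Rightarrow> nat set \<Rightarrow> bool" where
  "cell_partition n H Q R \<longleftrightarrow>
     R \<union> \<Union>Q = {1..n} \<and> pairwise disjnt Q \<and> {} \<notin> Q \<and> R \<inter> \<Union>Q = {} \<and>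
     (\<forall>h\<in>H. \<forall>P\<in>insert R Q. h ` P = P) \<and>
     (\<forall>P\<in>insert R Q. \<forall>x\<in>P. \<forall>y\<in>P. transpose x y \<in> H)"

lemma cell_partitionD:
  assumes "cell_partition n H Q R"
  shows "R \<union> \<Union>Q = {1..n}" and "pairwise disjnt Q" and "{} \<notin> Q" and "R \<inter> \<Union>Q = {}"
    and "\<And>h P. \<lbrakk>h \<in> H; P \<in> insert R Q\<rbrakk> \<Longrightarrow> h ` P = P"
    and "\<And>P x y. \<lbrakk>P \<in> insert R Q; x \<in> P; y \<in> P\<rbrakk> \<Longrightarrow> transpose x y \<in> H"
  using assms unfolding cell_partition_def by (elim conjE; metis)+

abbreviation sym_stab :: "nat \<Rightarrow> nat set set \<Rightarrow> (nat \<Rightarrow> nat) set" where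
  "sym_stab n B \<equiv> pw_stab (Sym n) subset_action B"

lemma sym_stab_iff: "h \<in> sym_stab n B \<longleftrightarrow> h permutes {1..n} \<and> (\<forall>b\<in>B. h ` b = b)"
  by (auto simp: pw_stab_def Sym_def subset_action_def)

lemma sym_stab_comp:
  assumes "g \<in> sym_stab n B" "h \<in> sym_stab n B"
  shows "g \<circ> h \<in> sym_stab n B"
  using assms unfolding sym_stab_iff by (metis image_comp permutes_compose)

lemma sym_stab_inj: "h \<in> sym_stab n B \<Longrightarrow> inj h"
  by (auto simp: sym_stab_iff permutes_inj)

lemma cell_partition_Nil: "cell_partition n (sym_stab n {}) {} {1..n}"
  unfolding cell_partition_def
  by (auto simp: sym_stab_iff permutes_image permutes_swap_id simp del: atLeastAtMost_iff)

text \<open>A permutation that preserves \<open>P\<close> and \<open>A\<close> preserves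
  \<open>P \<inter> A\<close> and \<open>P - A\<close>. A transposition of two points on the same
  side of \<open>A\<close> fixes \<open>A\<close> as a set.\<close>

lemma cell_partition_refine:
  assumes cp: "cell_partition n (sym_stab n B) Q R"
  shows "cell_partition n (sym_stab n (insert A B)) (refine A Q R) (R - A)"
proof -
  let ?H = "sym_stab n (insert A B)"
  note D = cell_partitionD[OF cp]
  have disj: "P = S" if "P \<in> insert R Q" "S \<in> insert R Q" "x \<in> P" "x \<in> S" for P S x
    using D(2,4) that unfolding pairwise_def disjnt_def by blast
  have un: "\<Union>(refine A Q R) = \<Union>Q \<union> R \<inter> A"
  proof -
    have "\<Union>(S - {{}}) = \<Union>S" for S :: "nat set set" by blast
    then have "\<Union>(refine A Q R) = (\<Union>P\<in>Q. P \<inter> A) \<union> (\<Union>P\<in>Q. P - A) \<union> R \<inter> A"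
      by (simp add: refine_def Un_ac)
    also have "\<dots> = \<Union>Q \<union> R \<inter> A" by blast
    finally show ?thesis .
  qed
  have 1: "(R - A) \<union> \<Union>(refine A Q R) = {1..n}"
    unfolding un using D(1) by blast
  have cells: "\<exists>P\<in>insert R Q. C = P \<inter> A \<or> C = P - A" if "C \<in> insert (R - A) (refine A Q R)" for C
    using that by (auto simp: refine_def)
  have 2: "pairwise disjnt (refine A Q R)"
  proof (rule pairwiseI)
    fix C C' assume C: "C \<in> refine A Q R" "C' \<in> refine A Q R" "C \<noteq> C'"
    obtain P where P: "P \<in> insert R Q" "C = P \<inter> A \<or> C = P - A" using cells C by blast
    obtain P' where P': "P' \<in> insert R Q" "C' = P' \<inter> A \<or> C' = P' - A" using cells C by blast
    show "disjnt C C'"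
    proof (cases "P = P'")
      case True
      then show ?thesis using P(2) P'(2) C(3) by (auto simp: disjnt_def)
    next
      case False
      then have "P \<inter> P' = {}" using disj P(1) P'(1) by blast
      then show ?thesis using P(2) P'(2) by (auto simp: disjnt_def)
    qed
  qed
  have 3: "{} \<notin> refine A Q R" by (simp add: refine_def)
  have R_disj: "(R - A) \<inter> \<Union>(refine A Q R) = {}"
    unfolding un using D(4) by blast
  have 4: "h ` C = C" if h: "h \<in> ?H" and C: "C \<in> insert (R - A) (refine A Q R)" for h C
  proof -
    obtain P where P: "P \<in> insert R Q" "C = P \<inter> A \<or> C = P - A" using cells[OF C] by blast
    have "h \<in> sym_stab n B" using h by (auto simp: sym_stab_iff)
    then have "h ` P = P" using D(5) P(1) by blast
    moreover have "h ` A = A" using h by (auto simp: sym_stab_iff)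
    ultimately show ?thesis
      using P(2) sym_stab_inj[OF h] by (metis image_Int image_set_diff)
  qed
  have 5: "transpose x y \<in> ?H"
    if C: "C \<in> insert (R - A) (refine A Q R)" and xy: "x \<in> C" "y \<in> C" for C x y
  proof -
    obtain P where P: "P \<in> insert R Q" "C = P \<inter> A \<or> C = P - A" using cells[OF C] by blast
    then have "transpose x y \<in> sym_stab n B"
      using D(6) xy by blast
    moreover have "transpose x y ` A = A"
      using P(2) xy by (intro transpose_image_eq) auto
    ultimately show ?thesis by (auto simp: sym_stab_iff)
  qed
  show ?thesis unfolding cell_partition_def using 1 2 3 R_disj 4 5 by simp
qed

section \<open>Exchange inequality for a largest orbit\<close>

text \<open>Let \<open>A'\<close> be \<open>A\<close> with a point of \<open>S\<close> replaced by
  one of \<open>P\<close>. Swapping u for v sends the triples (D, u, v) with D in the orbit of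
  \<open>A\<close>, u in \<open>P - D\<close> and v in \<open>S \<inter> D\<close> injectively to
  the reversed triples over the orbit of \<open>A'\<close>. That orbit is no larger, so the numbers
  of swaps per set compare as claimed.\<close>

lemma largest_orbit_exchange:
  assumes cp: "cell_partition n (sym_stab n B) Q R"
    and large: "in_largest_orbit (sym_stab n B) subset_action (r_subsets n r) A"
    and P: "P \<in> insert R Q" and S: "S \<in> insert R Q" and "P \<noteq> S"
  shows "card (P - A) * card (S \<inter> A) \<le> (card (S - A) + 1) * (card (P \<inter> A) + 1)"
proof (cases "P - A = {} \<or> S \<inter> A = {}")
  case True
  then show ?thesis by (metis card.empty le0 mult_0 mult_0_right)
next
  case False
  then obtain x y where x: "x \<in> P - A" and y: "y \<in> S \<inter> A" by blast
  let ?H = "sym_stab n B"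
  define A' where "A' = insert x (A - {y})"
  define O1 where "O1 = orbit_of ?H subset_action A"
  define O2 where "O2 = orbit_of ?H subset_action A'"
  note cpD = cell_partitionD[OF cp]
  have sub: "P \<subseteq> {1..n}" "S \<subseteq> {1..n}"
    unfolding cpD(1)[symmetric] using P S by blast+
  have dis: "P \<inter> S = {}"
    using cpD(2,4) P S \<open>P \<noteq> S\<close> unfolding pairwise_def disjnt_def by blast
  have fin: "finite P" "finite S" using sub by (auto intro: finite_subset)
  have A: "A \<subseteq> {1..n}" "card A = r"
    using large by (auto simp: in_largest_orbit_def r_subsets_def)
  then have finA: "finite A" by (auto intro: finite_subset)
  have "card A' = r"
    using x y A(2) finA card_Suc_Diff1[of A y] by (simp add: A'_def)
  then have "A' \<in> r_subsets n r"
    using A(1) x sub(1) by (auto simp: r_subsets_def A'_def)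
  then have le: "card O2 \<le> card O1"
    using large by (auto simp: in_largest_orbit_def O1_def O2_def)
  have finH: "finite ?H"
    by (rule finite_subset[OF _ finite_permutations[of "{1..n}"]]) (auto simp: sym_stab_iff)
  have finO: "finite O1" "finite O2" using finH by (auto simp: O1_def O2_def orbit_of_def)
  have "id \<in> ?H" by (auto simp: sym_stab_iff permutes_id)
  then have "O1 \<noteq> {}" by (auto simp: O1_def orbit_of_def)
  then have pos: "card O1 > 0" using finO by (simp add: card_gt_0_iff)
  \<comment> \<open>Since cells are invariant, the sizes of their intersections with a set are
    constant along its orbit. Every set of an orbit therefore contributes equally many
    swaps.\<close>
  have fixes_cells: "h ` P = P" "h ` S = S" if "h \<in> ?H" for h
    using cpD(5) P S that by blast+
  have card_h: "card (C \<inter> h ` D) = card (C \<inter> D)" "card (C - h ` D) = card (C - D)"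
    if "h \<in> ?H" "h ` C = C" for h C and D :: "nat set"
  proof -
    have inj: "inj h" using that sym_stab_inj by blast
    have "C \<inter> h ` D = h ` (C \<inter> D)" "C - h ` D = h ` (C - D)"
      using that(2) inj by (simp_all add: image_Int image_set_diff)
    then show "card (C \<inter> h ` D) = card (C \<inter> D)" "card (C - h ` D) = card (C - D)"
      using inj by (simp_all add: card_image inj_on_subset)
  qed
  define T1 where "T1 = (SIGMA D:O1. (P - D) \<times> (S \<inter> D))"
  define T2 where "T2 = (SIGMA D:O2. (P \<inter> D) \<times> (S - D))"
  have T1: "card T1 = card O1 * (card (P - A) * card (S \<inter> A))"
  proof -
    have "card T1 = (\<Sum>D\<in>O1. card ((P - D) \<times> (S \<inter> D)))"
      unfolding T1_def using finO fin by (intro card_SigmaI) auto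
    also have "\<dots> = (\<Sum>D\<in>O1. card (P - A) * card (S \<inter> A))"
      by (rule sum.cong)
        (auto simp: O1_def orbit_of_def subset_action_def card_cartesian_product card_h fixes_cells)
    finally show ?thesis by simp
  qed
  have T2: "card T2 = card O2 * ((card (P \<inter> A) + 1) * (card (S - A) + 1))"
  proof -
    have "P \<inter> A' = insert x (P \<inter> A)" "S - A' = insert y (S - A)"
      using x y dis by (auto simp: A'_def)
    then have cA': "card (P \<inter> A') = card (P \<inter> A) + 1" "card (S - A') = card (S - A) + 1"
      using x y fin by auto
    have "card T2 = (\<Sum>D\<in>O2. card ((P \<inter> D) \<times> (S - D)))"
      unfolding T2_def using finO fin by (intro card_SigmaI) auto
    also have "\<dots> = (\<Sum>D\<in>O2. card (P \<inter> A') * card (S - A'))"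
      by (rule sum.cong)
        (auto simp: O2_def orbit_of_def subset_action_def card_cartesian_product card_h fixes_cells)
    finally show ?thesis by (simp add: cA')
  qed
  \<comment> \<open>The image keeps u and v, so the swap can be undone; this gives
    injectivity.\<close>
  define f where "f = (\<lambda>(D, u, v). (insert u (D - {v}), u, v) :: nat set \<times> nat \<times> nat)"
  have "inj_on f T1"
  proof (rule inj_onI)
    fix s t assume st: "s \<in> T1" "t \<in> T1" "f s = f t"
    obtain D u v E u' v' where eq: "s = (D, u, v)" "t = (E, u', v')" by (metis prod_cases3)
    have uv: "u' = u" "v' = v" "insert u (D - {v}) = insert u (E - {v})"
      using st eq by (auto simp: f_def)
    have "u \<notin> D" "v \<in> D" "u \<notin> E" "v \<in> E" using st eq uv by (auto simp: T1_def)
    then have "D = E" using uv(3) by (metis Diff_iff insert_Diff insert_ident)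
    then show "s = t" using eq uv by simp
  qed
  moreover have "f ` T1 \<subseteq> T2"
  proof (rule image_subsetI)
    fix s assume s: "s \<in> T1"
    obtain D u v where eq: "s = (D, u, v)" by (metis prod_cases3)
    have D: "D \<in> O1" and u: "u \<in> P" "u \<notin> D" and v: "v \<in> S" "v \<in> D"
      using s eq by (auto simp: T1_def)
    obtain h where h: "h \<in> ?H" "D = h ` A"
      using D by (auto simp: O1_def orbit_of_def subset_action_def)
    have inj: "inj h" using h sym_stab_inj by blast
    obtain u0 where u0: "u = h u0" "u0 \<in> P" "u0 \<notin> A"
      using u h fixes_cells(1)[OF h(1)] by blast
    obtain v0 where v0: "v = h v0" "v0 \<in> A" "v0 \<in> S"
      using v h fixes_cells(2)[OF h(1)] inj_image_mem_iff[OF inj] by blast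
    \<comment> \<open>Only the swap of x for y is known to give the orbit of \<open>A'\<close>.
      Transpositions inside \<open>P\<close> and \<open>S\<close> carry x to u0 and y to v0, which
      reduces any other swap to that one.\<close>
    have g: "transpose x u0 \<in> ?H" "transpose y v0 \<in> ?H"
      using cpD(6)[OF P] cpD(6)[OF S] x y u0 v0 by blast+
    have "transpose y v0 x = x"
      using x y v0 by (intro transpose_apply_other) auto
    then have "transpose y v0 ` A' = insert x (A - {v0})"
      using y v0 by (simp add: A'_def image_set_diff transpose_image_eq)
    moreover have "transpose x u0 ` insert x (A - {v0}) = insert u0 (A - {v0})"
      using x u0 by (subst image_insert, subst transpose_image_eq) auto
    ultimately have "(h \<circ> (transpose x u0 \<circ> transpose y v0)) ` A' = h ` insert u0 (A - {v0})"
      by (simp only: image_comp[symmetric])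
    also have "\<dots> = insert u (D - {v})"
      using u0 v0 h inj by (simp add: image_set_diff)
    finally have "insert u (D - {v}) \<in> O2"
      using imageI[OF sym_stab_comp[OF h(1) sym_stab_comp[OF g]], of "\<lambda>k. k ` A'"]
      by (simp only: O2_def orbit_of_def subset_action_def)
    then show "f s \<in> T2"
      using u v dis by (auto simp: f_def T2_def eq)
  qed
  moreover have "finite T2" unfolding T2_def using finO fin by auto
  ultimately have "card T1 \<le> card T2" by (metis card_inj_on_le)
  also have "\<dots> \<le> card O1 * ((card (P \<inter> A) + 1) * (card (S - A) + 1))"
    unfolding T2 using le by (rule mult_le_mono1)
  finally have "card (P - A) * card (S \<inter> A) \<le> (card (P \<inter> A) + 1) * (card (S - A) + 1)"
    using pos unfolding T1 mult_le_cancel1 by blast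
  then show ?thesis by (simp only: mult.commute)
qed

lemma cell_partition_trivial:
  assumes cp: "cell_partition n (sym_stab n B) Q R"
    and small: "\<And>P. P \<in> insert R Q \<Longrightarrow> card P \<le> 1"
  shows "acts_trivially (sym_stab n B) subset_action (r_subsets n r)"
  unfolding acts_trivially_def
proof (intro ballI)
  fix h A assume h: "h \<in> sym_stab n B" and A: "A \<in> r_subsets n r"
  have "h x = x" if "x \<in> A" for x
  proof -
    have "x \<in> {1..n}" using A that by (auto simp: r_subsets_def)
    then have "x \<in> R \<union> \<Union>Q" using cell_partitionD(1)[OF cp] by simp
    then obtain P where P: "P \<in> insert R Q" "x \<in> P" by blast
    have "P \<subseteq> {1..n}" unfolding cell_partitionD(1)[OF cp, symmetric] using P by blast
    moreover have "h ` P = P" using cell_partitionD(5)[OF cp h P(1)] .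
    ultimately have "h x \<in> P" "finite P" using P by (auto intro: finite_subset)
    then show ?thesis using small[OF P(1)] P(2) card_le_Suc0_iff_eq[of P] by simp
  qed
  then show "subset_action h A = A" by (simp add: subset_action_def)
qed

section \<open>One greedy step seen on the cells\<close>

text \<open>The group survives only in \<open>exchange\<close>; all further arguments about a single
  step concern sizes of cells.\<close>

locale greedy_step =
  fixes Q :: "'a set set" and R A :: "'a set" and r :: nat
  assumes finQ: "finite Q" and fin_cell: "\<And>P. P \<in> Q \<Longrightarrow> finite P" and finR: "finite R"
    and nonempty: "{} \<notin> Q" and disj: "pairwise disjnt Q" and disjR: "R \<inter> \<Union>Q = {}"
    and A_sub: "A \<subseteq> R \<union> \<Union>Q" and card_A: "card A = r"
    and exchange: "\<And>P S. \<lbrakk>P \<in> insert R Q; S \<in> insert R Q; P \<noteq> S\<rbrakk> \<Longrightarrow>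
      card (P - A) * card (S \<inter> A) \<le> (card (S - A) + 1) * (card (P \<inter> A) + 1)"
begin

abbreviation "Q' \<equiv> refine A Q R"

definition "chosen = {P \<in> Q. P \<inter> A \<noteq> {}}"

text \<open>This is the economical step of the overview: every cell of \<open>Q\<close> that is
  touched splits into a singleton and a nonempty remainder.\<close>

definition "wasteless \<longleftrightarrow> (\<forall>P\<in>Q. P \<inter> A \<noteq> {} \<longrightarrow> card (P \<inter> A) = 1 \<and> P - A \<noteq> {})"

lemma disjoint_cells: "\<lbrakk>P \<in> Q; S \<in> Q; x \<in> P; x \<in> S\<rbrakk> \<Longrightarrow> P = S"
  using disj unfolding pairwise_def disjnt_def by blast

lemma R_notin: "R \<notin> Q"
proof
  assume "R \<in> Q"
  then have "R \<inter> \<Union>Q = R" by blast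
  with disjR \<open>R \<in> Q\<close> nonempty show False by simp
qed

lemma card_split:
  assumes "P \<in> insert R Q"
  shows "card P = card (P \<inter> A) + card (P - A)"
  using assms fin_cell finR card_Int_Diff[of P A] by auto

lemma finite_chosen: "finite chosen"
  using finQ by (auto simp: chosen_def)

lemma card_A_sum: "r = card (R \<inter> A) + (\<Sum>P\<in>chosen. card (P \<inter> A))"
proof -
  have "A = (R \<inter> A) \<union> (\<Union>P\<in>chosen. P \<inter> A)"
    using A_sub by (auto simp: chosen_def)
  moreover have "card ((R \<inter> A) \<union> (\<Union>P\<in>chosen. P \<inter> A))
      = card (R \<inter> A) + card (\<Union>P\<in>chosen. P \<inter> A)"
    using finR fin_cell finite_chosen disjR by (intro card_Un_disjoint) (auto simp: chosen_def)
  moreover have "card (\<Union>P\<in>chosen. P \<inter> A) = (\<Sum>P\<in>chosen. card (P \<inter> A))"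
    using finite_chosen fin_cell disjoint_cells
    by (intro card_UN_disjoint) (auto simp: chosen_def)
  ultimately show ?thesis using card_A by simp
qed

lemma card_chosen: "card (R \<inter> A) + card chosen \<le> r"
proof -
  have "card chosen \<le> (\<Sum>P\<in>chosen. card (P \<inter> A))"
    using fin_cell unfolding card_eq_sum
    by (intro sum_mono) (auto simp: chosen_def Suc_le_eq card_gt_0_iff simp flip: card_eq_sum)
  then show ?thesis using card_A_sum by linarith
qed

lemma finite_refine: "finite Q'"
  using finQ by (auto simp: refine_def)

text \<open>Every old cell leaves a nonempty part, and parts of different cells are disjoint. This
  is the count for steps that may be uneconomical.\<close>

lemma card_refine_mono: "card Q \<le> card Q'"
proof (rule card_inj_on_le[OF _ _ finite_refine])
  define f where "f P = (if P - A = {} then P \<inter> A else P - A)" for P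
  have f: "f P \<subseteq> P" "f P \<noteq> {}" if "P \<in> Q" for P
  proof -
    have "P \<noteq> {}" using that nonempty by blast
    then show "f P \<noteq> {}" unfolding f_def by (metis Diff_eq_empty_iff Int_absorb2)
  qed (auto simp: f_def)
  show "inj_on f Q"
  proof (rule inj_onI)
    fix P S assume PS: "P \<in> Q" "S \<in> Q" "f P = f S"
    obtain x where "x \<in> f P" using f(2)[OF PS(1)] by blast
    then show "P = S" using disjoint_cells[OF PS(1,2)] f(1) PS by blast
  qed
  show "f ` Q \<subseteq> Q'"
  proof (rule image_subsetI)
    fix P assume P: "P \<in> Q"
    have "f P = P \<inter> A \<or> f P = P - A" by (simp add: f_def)
    then show "f P \<in> Q'" using f(2)[OF P] P unfolding refine_def by blast
  qed
qed

text \<open>The remainders \<open>P - A\<close> replace the old cells, and each of the r - |R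
  \<inter> A| points picked outside \<open>R\<close> is a new singleton cell.\<close>

lemma card_refine_wasteless:
  assumes wasteless
  shows "card Q + r \<le> card Q' + card (R \<inter> A)"
proof -
  have ne: "P - A \<noteq> {}" if "P \<in> Q" for P
    using assms that nonempty unfolding wasteless_def by (metis Diff_triv)
  have "inj_on (\<lambda>P. P - A) Q"
    by (rule inj_onI) (metis ne disjoint_cells ex_in_conv DiffD1)
  moreover have "inj_on (\<lambda>P. P \<inter> A) chosen"
    by (rule inj_onI) (metis (mono_tags, lifting) chosen_def disjoint_cells ex_in_conv IntD1 mem_Collect_eq)
  moreover have "((\<lambda>P. P - A) ` Q) \<inter> ((\<lambda>P. P \<inter> A) ` chosen) = {}"
    by (auto simp: chosen_def)
  ultimately have "card ((\<lambda>P. P - A) ` Q \<union> (\<lambda>P. P \<inter> A) ` chosen) = card Q + card chosen"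
    using finQ finite_chosen by (simp add: card_Un_disjoint card_image)
  moreover have "(\<lambda>P. P - A) ` Q \<union> (\<lambda>P. P \<inter> A) ` chosen \<subseteq> Q'"
    using ne by (auto simp: refine_def chosen_def)
  ultimately have "card Q + card chosen \<le> card Q'"
    by (metis card_mono finite_refine)
  moreover have "(\<Sum>P\<in>chosen. card (P \<inter> A)) = card chosen"
    using assms by (simp add: chosen_def wasteless_def)
  ultimately show ?thesis using card_A_sum by linarith
qed

lemma card_R_diff: "card (R - A) + card (R \<inter> A) = card R"
  using card_split[of R] by simp

lemma refine_cases:
  assumes "C \<in> Q'"
  obtains P where "P \<in> chosen" "C = P \<inter> A" | P where "P \<in> Q" "C = P - A" | "C = R \<inter> A"
  using assms by (auto simp: refine_def chosen_def)

lemma exists_unchosen: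
  assumes "K \<subseteq> Q" "card K > r"
  obtains U where "U \<in> K" "U \<inter> A = {}"
proof -
  have "\<not> K \<subseteq> chosen"
  proof
    assume "K \<subseteq> chosen"
    from card_mono[OF finite_chosen this] show False using card_chosen assms(2) by linarith
  qed
  then show ?thesis using that assms(1) by (auto simp: chosen_def)
qed

text \<open>This is \<open>exchange\<close> with \<open>P = U\<close>, where the last factor is 1.
  An untouched cell of size m forces any cell with k picks to keep at least m k - 1 points.\<close>

lemma unchosen_bound:
  assumes "U \<in> Q" "U \<inter> A = {}" "S \<in> insert R Q"
  shows "card U * card (S \<inter> A) \<le> card (S - A) + 1"
proof (cases "S = U")
  case True
  then show ?thesis using assms by simp
next
  case False
  have "U - A = U" using assms by blast
  then show ?thesis using exchange[of U S] assms False by simp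
qed

text \<open>This is \<open>exchange\<close> in the other direction: \<open>V\<close> has at least
  one pick, so |V - A| + 1 <= |V|. A small touched cell thus limits what remains of every other
  cell.\<close>

lemma chosen_bound:
  assumes "V \<in> chosen" "S \<in> insert R Q" "S \<noteq> V"
  shows "card (S - A) \<le> card V * (card (S \<inter> A) + 1)"
proof -
  have V: "V \<in> Q" and ne: "V \<inter> A \<noteq> {}" using assms by (auto simp: chosen_def)
  then have pos: "card (V \<inter> A) \<ge> 1" using fin_cell by (simp add: Suc_le_eq card_gt_0_iff)
  have "card (S - A) \<le> card (S - A) * card (V \<inter> A)" using pos by simp
  also have "\<dots> \<le> (card (V - A) + 1) * (card (S \<inter> A) + 1)"
    using exchange assms V by blast
  also have "\<dots> \<le> card V * (card (S \<inter> A) + 1)"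
    using pos card_split[of V] V by (intro mult_le_mono1) simp
  finally show ?thesis .
qed

end

lemma greedy_stepI:
  assumes cp: "cell_partition n (sym_stab n B) Q R"
    and large: "in_largest_orbit (sym_stab n B) subset_action (r_subsets n r) A"
  shows "greedy_step Q R A r"
proof
  have un: "R \<union> \<Union>Q = {1..n}" using cp by (simp add: cell_partition_def)
  have "finite (R \<union> \<Union>Q)" unfolding un by simp
  then show "finite Q" "finite R" "\<And>P. P \<in> Q \<Longrightarrow> finite P"
    by (auto intro: finite_UnionD finite_subset)
  show "{} \<notin> Q" "pairwise disjnt Q" "R \<inter> \<Union>Q = {}" using cell_partitionD[OF cp] by simp_all
  show "A \<subseteq> R \<union> \<Union>Q" "card A = r"
    using large un by (auto simp: in_largest_orbit_def r_subsets_def)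
qed (rule largest_orbit_exchange[OF cp large])

section \<open>Phases of the process and decay of the rest\<close>

text \<open>Here x counts the main cells of size M and m is the size of R. Each step touching a main cell
  lowers x by at most r, so the thresholds 2r and r record one and two such steps since M last
  dropped; the bounds result from M^2 + 1 by one and two applications of the decay estimate
  m' (M + 1) \<le> M (m + 1).\<close>
definition rest_bound :: "nat \<Rightarrow> nat \<Rightarrow> nat \<Rightarrow> nat \<Rightarrow> bool" where
  "rest_bound r M x m \<longleftrightarrow> m \<le> M\<^sup>2 + 1 \<and> (x \<le> 2 * r \<longrightarrow> m + M \<le> M\<^sup>2 + 2) \<and>
     (x \<le> r \<longrightarrow> m * (M + 1) + M\<^sup>2 \<le> M^3 + 3 * M)"

text \<open>The alternative M = r, x = 3r is the state before any main cell is touched, where R may still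
  be arbitrarily large.\<close>
definition main_phase :: "nat \<Rightarrow> 'a set set \<Rightarrow> 'a set \<Rightarrow> bool" where
  "main_phase r Q R \<longleftrightarrow> (\<exists>M K. 2 \<le> M \<and> K \<subseteq> Q \<and> card K = 3 * r \<and>
     (\<forall>P\<in>K. card P = M \<or> Suc (card P) = M) \<and> {P \<in> K. card P = M} \<noteq> {} \<and>
     (\<forall>P\<in>Q. card P \<le> Suc M) \<and>
     (M = r \<and> card {P \<in> K. card P = M} = 3 * r \<or>
      rest_bound r M (card {P \<in> K. card P = M}) (card R)))"

text \<open>The number of cells serves to guarantee an untouched cell at each step, since a step
  touches at most r of them.\<close>

definition end_phase :: "nat \<Rightarrow> 'a set set \<Rightarrow> 'a set \<Rightarrow> bool" where
  "end_phase r Q R \<longleftrightarrow> 3 * r \<le> card Q \<and> (\<forall>P\<in>insert R Q. card P \<le> 2)"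

text \<open>Eliminating a, the number of picks from \<open>R\<close>, turns
  \<open>chosen_bound\<close> for a cell of size M into shrinkage of \<open>R\<close> by a factor of
  about M / (M + 1).\<close>

lemma decay:
  fixes m m' a M :: nat
  assumes "m' \<le> M * (a + 1)" "m' + a = m"
  shows "m' * (M + 1) \<le> M * (m + 1)"
  using assms by (auto simp: algebra_simps)

lemma rest_bound_mono:
  assumes "rest_bound r M x m" "m' \<le> m"
  shows "rest_bound r M x m'"
  using assms mult_le_mono1[OF assms(2), of "M + 1"] unfolding rest_bound_def by linarith

text \<open>One decay turns m <= M^2 + 1 into the middle bound, whatever x' is. If x' <= r then x <=
  2 r, so the middle bound held already, and its decay is the last bound.\<close>

lemma rest_bound_decay:
  assumes b: "rest_bound r M x m" and d: "m' * (M + 1) \<le> M * (m + 1)"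
    and m: "m' \<le> m" and x: "x \<le> x' + r"
  shows "rest_bound r M x' m'"
proof -
  have m1: "m \<le> M\<^sup>2 + 1" using b by (simp add: rest_bound_def)
  have "m' + M \<le> M\<^sup>2 + 2"
  proof (rule ccontr)
    assume "\<not> m' + M \<le> M\<^sup>2 + 2"
    then have "(M\<^sup>2 + 3) * (M + 1) \<le> (m' + M) * (M + 1)" by (intro mult_le_mono1) simp
    moreover have "M * (m + 1) \<le> M * (M\<^sup>2 + 2)" using m1 by (intro mult_le_mono2) simp
    ultimately show False using d by (simp add: algebra_simps power2_eq_square)
  qed
  moreover have "m' * (M + 1) + M\<^sup>2 \<le> M^3 + 3 * M" if "x' \<le> r"
  proof -
    have "m + M \<le> M\<^sup>2 + 2" using b that x by (simp add: rest_bound_def)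
    then have "M * (m + 1 + M) \<le> M * (M\<^sup>2 + 3)" by (intro mult_le_mono2) simp
    then show ?thesis using d by (simp add: algebra_simps power2_eq_square power3_eq_cube)
  qed
  ultimately show ?thesis using m m1 by (simp add: rest_bound_def)
qed

text \<open>A third decay, starting from the last bound of \<open>rest_bound\<close>, reaches the
  first bound for M - 1.\<close>

lemma rest_bound_drop:
  fixes m m' M :: nat
  assumes b: "m * (M + 1) + M\<^sup>2 \<le> M^3 + 3 * M" and d: "m' * (M + 1) \<le> M * (m + 1)"
    and M: "M \<ge> 3"
  shows "m' \<le> (M - 1)\<^sup>2 + 1"
proof (rule ccontr)
  assume neg: "\<not> ?thesis"
  \<comment> \<open>The substitution removes the truncated subtraction M - 1. The two sides of the
    final inequality then differ by k^3 + 5 k^2 + 6 k + 3, which is positive.\<close>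
  define k where "k = M - 3"
  have Mk: "M = k + 3" using M by (simp add: k_def)
  have "m' \<ge> (k + 2)\<^sup>2 + 2" using neg by (simp add: Mk)
  then have "((k + 2)\<^sup>2 + 2) * (k + 4)\<^sup>2 \<le> m' * (k + 4)\<^sup>2" by (rule mult_le_mono1)
  moreover have "m' * (k + 4)\<^sup>2 \<le> (k + 3) * (m + 1) * (k + 4)"
    using mult_le_mono1[OF d, of "k + 4"] by (simp add: Mk power2_eq_square algebra_simps)
  moreover have "(k + 3) * (m + 1) * (k + 4) + (k + 3)^3
      \<le> (k + 3) * ((k + 3)^3 + 3 * (k + 3) + (k + 4))"
    using mult_le_mono2[OF b, of "k + 3"]
    by (simp add: Mk power2_eq_square power3_eq_cube algebra_simps)
  ultimately have "((k + 2)\<^sup>2 + 2) * (k + 4)\<^sup>2 + (k + 3)^3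
      \<le> (k + 3) * ((k + 3)^3 + 3 * (k + 3) + (k + 4))"
    by linarith
  then show False
    by (simp add: power2_eq_square power3_eq_cube algebra_simps)
qed

section \<open>Transitions between the phases\<close>

context greedy_step
begin

text \<open>The untouched cell \<open>U\<close> of full size M yields M k <= |S - A| + 1 for a cell
  with k picks. For cells of size at most M + 1 this excludes k >= 2, and a touched cell keeps at
  least M - 1 points. Hence the same M serves after the step.\<close>

lemma main_phase_keep:
  assumes r: "r \<ge> 1" and M: "2 \<le> M" and K: "K \<subseteq> Q" "card K = 3 * r"
    and sizes: "\<And>P. P \<in> K \<Longrightarrow> card P = M \<or> Suc (card P) = M"
    and max: "\<And>P. P \<in> Q \<Longrightarrow> card P \<le> Suc M"
    and rest: "M = r \<and> card {P \<in> K. card P = M} = 3 * r \<or>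
      rest_bound r M (card {P \<in> K. card P = M}) (card R)"
    and U: "U \<in> K" "card U = M" "U \<inter> A = {}"
  shows "wasteless \<and> main_phase r Q' (R - A)"
proof
  have bound: "M * card (S \<inter> A) \<le> card (S - A) + 1" if "S \<in> insert R Q" for S
    using unchosen_bound[of U S] U K that by auto
  have one: "card (P \<inter> A) = 1 \<and> card (P - A) + 1 \<ge> M" if "P \<in> chosen" for P
  proof -
    have P: "P \<in> Q" "card (P \<inter> A) > 0"
      using that fin_cell by (auto simp: chosen_def card_gt_0_iff)
    have "card (P \<inter> A) < 2"
    proof (rule ccontr)
      assume "\<not> card (P \<inter> A) < 2"
      then have "M * 2 \<le> M * card (P \<inter> A)" "card (P \<inter> A) \<ge> 2" by simp_all
      then show False
        using bound[OF insertI2[OF P(1)]] card_split[OF insertI2[OF P(1)]] max[OF P(1)] by linarith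
    qed
    then have "card (P \<inter> A) = 1" using P by simp
    then show ?thesis using bound[of P] P(1) by simp
  qed
  show wl: wasteless
    unfolding wasteless_def
  proof (intro ballI impI)
    fix P assume "P \<in> Q" "P \<inter> A \<noteq> {}"
    then have "P \<in> chosen" by (simp add: chosen_def)
    from one[OF this] M have "card (P \<inter> A) = 1" "card (P - A) \<noteq> 0" by auto
    then show "card (P \<inter> A) = 1 \<and> P - A \<noteq> {}" by (metis card.empty)
  qed
  let ?X = "{P \<in> K. card P = M}"
  define K' where "K' = (\<lambda>P. P - A) ` K"
  let ?X' = "{P \<in> K'. card P = M}"
  define c where "c = card (K \<inter> chosen)"
  have finK: "finite K" using K finQ by (auto intro: finite_subset)
  have ne: "P - A \<noteq> {}" if "P \<in> Q" for P
    using wl that nonempty unfolding wasteless_def by (metis Diff_triv)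
  have inj: "inj_on (\<lambda>P. P - A) K"
    by (rule inj_onI) (metis K(1) subsetD ne disjoint_cells ex_in_conv DiffD1)
  have K': "K' \<subseteq> Q'" "card K' = 3 * r"
    using K ne inj by (auto simp: K'_def refine_def card_image)
  \<comment> \<open>A main cell of size M - 1 cannot be touched: only M - 2 points would
    remain.\<close>
  have chosen_main: "card P = M \<and> Suc (card (P - A)) = M" if "P \<in> K" "P \<in> chosen" for P
    using one[OF that(2)] card_split[of P] sizes[OF that(1)] K that(1) by auto
  have unchosen: "P - A = P" if "P \<in> Q" "P \<notin> chosen" for P
    using that by (auto simp: chosen_def)
  have sizes': "card P = M \<or> Suc (card P) = M" if P: "P \<in> K'" for P
  proof -
    obtain S where S: "S \<in> K" "P = S - A" using P unfolding K'_def by blast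
    show ?thesis
    proof (cases "S \<in> chosen")
      case True
      then show ?thesis using chosen_main[OF S(1)] S(2) by simp
    next
      case False
      then show ?thesis using unchosen[of S] sizes[OF S(1)] S K by auto
    qed
  qed
  have X': "?X' = (\<lambda>P. P - A) ` (?X - chosen)"
  proof (intro set_eqI iffI)
    fix P assume "P \<in> ?X'"
    then obtain S where S: "S \<in> K" "P = S - A" "card P = M" by (auto simp: K'_def)
    have "S \<notin> chosen" using chosen_main[of S] S by auto
    moreover from this have "S - A = S" using unchosen[of S] S(1) K(1) by blast
    ultimately have "S \<in> ?X - chosen" using S by simp
    then show "P \<in> (\<lambda>P. P - A) ` (?X - chosen)" unfolding S(2) by (rule imageI)
  next
    fix P assume "P \<in> (\<lambda>P. P - A) ` (?X - chosen)"
    then obtain S where "S \<in> ?X" "S \<notin> chosen" "P = S - A" by auto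
    moreover from this have "S - A = S" using unchosen[of S] K(1) by blast
    ultimately show "P \<in> ?X'" unfolding K'_def by force
  qed
  have ne': "?X' \<noteq> {}"
    unfolding X' using U by (auto simp: chosen_def)
  have cR: "card (R \<inter> A) \<le> r" using card_chosen by simp
  \<comment> \<open>The new cell cut from \<open>R\<close> must respect the maximum M + 1. For M = r
    the size of \<open>A\<close> suffices; otherwise |R| <= M^2 + 1 gives (M + 1) |R \<inter> A| <=
    M^2 + 2.\<close>
  have cRA: "card (R \<inter> A) \<le> Suc M"
  proof (cases "M = r")
    case False
    then have "card R \<le> M\<^sup>2 + 1" using rest by (auto simp: rest_bound_def)
    then have le: "M * card (R \<inter> A) + card (R \<inter> A) \<le> M\<^sup>2 + 2"
      using bound[of R] card_R_diff by simp
    show ?thesis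
    proof (rule ccontr)
      assume "\<not> ?thesis"
      then have "M * (M + 2) \<le> M * card (R \<inter> A)" by (intro mult_le_mono2) simp
      with le M show False by (simp add: power2_eq_square)
    qed
  qed (use cR in simp)
  have max': "card P \<le> Suc M" if "P \<in> Q'" for P
    using that
  proof (cases rule: refine_cases)
    case (1 S) then show ?thesis using one M by simp
  next
    case (2 S) then show ?thesis using max[of S] card_split[of S] by simp
  qed (use cRA in simp)
  have rest': "M = r \<and> card ?X' = 3 * r \<or> rest_bound r M (card ?X') (card (R - A))"
  proof -
    have Kc: "K \<inter> chosen \<subseteq> ?X" using chosen_main by auto
    have "card ?X' = card (?X - chosen)"
      unfolding X' by (rule card_image) (rule inj_on_subset[OF inj], auto)
    also have "?X - chosen = ?X - (K \<inter> chosen)" by auto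
    also have "card \<dots> = card ?X - c"
      unfolding c_def by (rule card_Diff_subset) (use Kc finK in auto)
    finally have cX': "card ?X' = card ?X - c" .
    have cle: "card (R \<inter> A) + c \<le> r"
      using card_chosen card_mono[OF finite_chosen, of "K \<inter> chosen"] by (simp add: c_def)
    show ?thesis
    proof (cases "K \<inter> chosen = {}")
      case True
      then have "card ?X' = card ?X" using cX' by (simp add: c_def)
      moreover have "card (R - A) \<le> card R" using card_R_diff by simp
      ultimately show ?thesis using rest rest_bound_mono by auto
    next
      case False
      then obtain V where V: "V \<in> K" "V \<in> chosen" by blast
      have cpos: "c \<ge> 1" using False finK by (simp add: c_def Suc_le_eq card_gt_0_iff)
      have "R \<noteq> V" using V R_notin K by auto
      then have mb: "card (R - A) \<le> M * (card (R \<inter> A) + 1)"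
        using chosen_bound[of V R] V chosen_main[of V] by simp
      from rest show ?thesis
      proof
        \<comment> \<open>This is the first step that touches a main cell, so nothing is known about
          \<open>R\<close> beforehand. At most r - 1 picks lie in \<open>R\<close>, so at most M^2
          points of it remain. If only 2 r full cells are left, all picks were main cells and at
          most M points of \<open>R\<close> remain.\<close>
        assume first: "M = r \<and> card ?X = 3 * r"
        have "card (R - A) \<le> M\<^sup>2"
        proof -
          have "M * (card (R \<inter> A) + 1) \<le> M * M"
            using first cle cpos by (intro mult_le_mono2) simp
          then show ?thesis using mb by (simp add: power2_eq_square)
        qed
        moreover have "card (R - A) + M \<le> M\<^sup>2 + 2" if "card ?X' \<le> 2 * r"
        proof -
          have "card (R \<inter> A) = 0" using that cX' first cle by linarith
          then have "card (R - A) \<le> M" using mb by simp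
          moreover have "2 * M \<le> M\<^sup>2" using M by (simp add: power2_eq_square)
          ultimately show ?thesis by simp
        qed
        moreover have "\<not> card ?X' \<le> r" using cX' first cle r by linarith
        ultimately show ?thesis by (simp add: rest_bound_def)
      next
        assume "rest_bound r M (card ?X) (card R)"
        moreover have "card (R - A) * (M + 1) \<le> M * (card R + 1)"
          by (rule decay[OF mb card_R_diff])
        ultimately have "rest_bound r M (card ?X') (card (R - A))"
          by (rule rest_bound_decay) (use card_R_diff cX' cle in simp_all)
        then show ?thesis ..
      qed
    qed
  qed
  show "main_phase r Q' (R - A)"
    unfolding main_phase_def using M K' sizes' ne' max' rest'
    by (intro exI[of _ M] exI[of _ K'] conjI ballI)
qed

text \<open>All full cells are touched, so there are at most r of them and the strongest bound on
  \<open>R\<close> is available. Some main cell is untouched and has size M - 1, which still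
  excludes two picks from one cell if M >= 3. For M = 2 all cells shrink to size at most 2.\<close>

lemma main_phase_drop:
  assumes r: "r \<ge> 1" and M: "2 \<le> M" and K: "K \<subseteq> Q" "card K = 3 * r"
    and sizes: "\<And>P. P \<in> K \<Longrightarrow> card P = M \<or> Suc (card P) = M"
    and X: "{P \<in> K. card P = M} \<noteq> {}"
    and max: "\<And>P. P \<in> Q \<Longrightarrow> card P \<le> Suc M"
    and rest: "M = r \<and> card {P \<in> K. card P = M} = 3 * r \<or>
      rest_bound r M (card {P \<in> K. card P = M}) (card R)"
    and drop: "\<And>P. \<lbrakk>P \<in> K; card P = M\<rbrakk> \<Longrightarrow> P \<inter> A \<noteq> {}"
  shows "wasteless \<and> main_phase r Q' (R - A) \<or> end_phase r Q' (R - A)"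
proof -
  let ?X = "{P \<in> K. card P = M}"
  have finK: "finite K" using K finQ by (auto intro: finite_subset)
  have Xc: "?X \<subseteq> chosen" using drop K by (auto simp: chosen_def)
  then have Xr: "card ?X \<le> r"
    using card_mono[OF finite_chosen Xc] card_chosen by simp
  then have rest': "card R \<le> M\<^sup>2 + 1" "card R * (M + 1) + M\<^sup>2 \<le> M^3 + 3 * M"
    using rest r by (auto simp: rest_bound_def)
  obtain U where U: "U \<in> K" "U \<inter> A = {}"
    using exists_unchosen[OF K(1)] K(2) r by auto
  have cU: "card U = M - 1" using sizes[OF U(1)] drop[OF U(1)] U(2) by auto
  have bound: "(M - 1) * card (S \<inter> A) \<le> card (S - A) + 1" if "S \<in> insert R Q" for S
    using unchosen_bound[of U S] U K that cU by auto
  obtain V where V: "V \<in> K" "card V = M" using X by blast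
  then have Vc: "V \<in> chosen" using Xc by blast
  \<comment> \<open>A cell of size M + 1 must be touched, by \<open>chosen_bound\<close> with
    \<open>V\<close> of size M. So the maximum drops together with M.\<close>
  have unchosen_le: "card P \<le> M" if "P \<in> Q" "P \<notin> chosen" for P
  proof -
    have "P \<inter> A = {}" "P - A = P" using that by (auto simp: chosen_def)
    then show ?thesis using chosen_bound[OF Vc, of P] that Vc V by auto
  qed
  have "R \<noteq> V" using V R_notin K by auto
  then have "card (R - A) \<le> M * (card (R \<inter> A) + 1)"
    using chosen_bound[OF Vc, of R] V by simp
  then have dec: "card (R - A) * (M + 1) \<le> M * (card R + 1)"
    by (rule decay[OF _ card_R_diff])
  have chosen_pos: "card (P \<inter> A) > 0" if "P \<in> chosen" for P
    using that fin_cell by (auto simp: chosen_def card_gt_0_iff)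
  have diff_le: "card (P - A) \<le> M" if "P \<in> Q" for P
  proof (cases "P \<in> chosen")
    case True
    then show ?thesis using chosen_pos[of P] card_split[of P] max[OF that] that by auto
  next
    case False
    then have "P - A = P" by (auto simp: chosen_def that)
    then show ?thesis using unchosen_le[OF that False] by simp
  qed
  show ?thesis
  proof (cases "M = 2")
    case True
    \<comment> \<open>For M = 2 the last bound reads 3 |R| + 4 <= 14.\<close>
    have R: "card R \<le> 3" using rest' True by simp
    have "card (R - A) \<le> 2" using dec True R by simp
    moreover have "card P \<le> 2" if "P \<in> Q'" for P
      using that
    proof (cases rule: refine_cases)
      case (1 S)
      then have "S \<in> Q" by (simp add: chosen_def)
      then show ?thesis using bound[of S] card_split[of S] max[of S] True 1 by simp
    next
      case (2 S)
      then show ?thesis using diff_le True by simp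
    next
      case 3
      then show ?thesis using bound[of R] card_R_diff R True by simp
    qed
    moreover have "3 * r \<le> card Q'"
      using card_refine_mono card_mono[OF finQ K(1)] K(2) by simp
    ultimately show ?thesis by (simp add: end_phase_def)
  next
    case False
    then have M3: "M \<ge> 3" using M by simp
    have one: "card (P \<inter> A) = 1 \<and> card (P - A) \<ge> 1" if "P \<in> chosen" for P
    proof -
      have P: "P \<in> Q" using that by (simp add: chosen_def)
      have "card (P \<inter> A) < 2"
      proof (rule ccontr)
        assume "\<not> card (P \<inter> A) < 2"
        then have "(M - 1) * 2 \<le> (M - 1) * card (P \<inter> A)" "card (P \<inter> A) \<ge> 2" by simp_all
        then show False
          using bound[OF insertI2[OF P]] card_split[OF insertI2[OF P]] max[OF P] M3 by linarith
      qed
      then have "card (P \<inter> A) = 1" using chosen_pos[OF that] by simp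
      then show ?thesis using bound[of P] P M3 by simp
    qed
    have wl: wasteless
      unfolding wasteless_def
    proof (intro ballI impI)
      fix P assume "P \<in> Q" "P \<inter> A \<noteq> {}"
      then have "P \<in> chosen" by (simp add: chosen_def)
      from one[OF this] have "card (P \<inter> A) = 1" "card (P - A) \<noteq> 0" by auto
      then show "card (P \<inter> A) = 1 \<and> P - A \<noteq> {}" by (metis card.empty)
    qed
    define K' where "K' = (\<lambda>P. P - A) ` K"
    let ?X' = "{P \<in> K'. card P = M - 1}"
    have ne: "P - A \<noteq> {}" if "P \<in> Q" for P
      using wl that nonempty unfolding wasteless_def by (metis Diff_triv)
    have inj: "inj_on (\<lambda>P. P - A) K"
      by (rule inj_onI) (metis K(1) subsetD ne disjoint_cells ex_in_conv DiffD1)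
    have K': "K' \<subseteq> Q'" "card K' = 3 * r"
      using K ne inj by (auto simp: K'_def refine_def card_image)
    have diff: "card (P - A) = (if P \<in> chosen then card P - 1 else card P)" if "P \<in> Q" for P
    proof (cases "P \<in> chosen")
      case True
      then show ?thesis using one[OF True] card_split[of P] that by simp
    next
      case False
      then have "P - A = P" by (auto simp: chosen_def that)
      then show ?thesis using False by simp
    qed
    have sizes': "card P = M - 1 \<or> Suc (card P) = M - 1" if P: "P \<in> K'" for P
    proof -
      obtain S where S: "S \<in> K" "P = S - A" using P unfolding K'_def by blast
      have "S \<in> Q" "card S = M \<Longrightarrow> S \<in> chosen" using S(1) K(1) Xc by blast+
      then show ?thesis
        using diff[of S] sizes[OF S(1)] S(2) M3 by (auto split: if_splits)
    qed
    have X': "(\<lambda>P. P - A) ` (K - (chosen - ?X)) \<subseteq> ?X'"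
    proof (rule image_subsetI)
      fix P assume P: "P \<in> K - (chosen - ?X)"
      have "P \<in> Q" "P \<in> chosen \<longleftrightarrow> card P = M" using P K(1) Xc by blast+
      then have "card (P - A) = M - 1" using diff[of P] sizes[of P] P by auto
      then show "P - A \<in> ?X'" using P by (simp add: K'_def)
    qed
    \<comment> \<open>A main cell misses the new full size M - 1 only if it was touched at size M -
      1. There are fewer than r such cells, as \<open>?X\<close> takes at least one of the touched
      ones. The conditional clauses of \<open>rest_bound\<close> are then vacuous.\<close>
    have "2 * r < card ?X'"
    proof -
      have "card (chosen - ?X) < card chosen"
        by (rule psubset_card_mono[OF finite_chosen]) (use Xc X in blast)
      then have "card (chosen - ?X) < r" using card_chosen by simp
      then have "2 * r < card K - card (chosen - ?X)" using K by simp
      also have "\<dots> \<le> card (K - (chosen - ?X))"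
        by (rule diff_card_le_card_Diff) (use finite_chosen in simp)
      also have "\<dots> = card ((\<lambda>P. P - A) ` (K - (chosen - ?X)))"
        by (rule card_image[symmetric]) (rule inj_on_subset[OF inj], auto)
      also have "\<dots> \<le> card ?X'"
        by (rule card_mono[OF _ X']) (use finK in \<open>simp add: K'_def\<close>)
      finally show ?thesis .
    qed
    moreover have "card (R - A) \<le> (M - 1)\<^sup>2 + 1"
      by (rule rest_bound_drop[OF rest'(2) dec M3])
    ultimately have "rest_bound r (M - 1) (card ?X') (card (R - A))"
      using r by (simp add: rest_bound_def)
    moreover have "?X' \<noteq> {}" using \<open>2 * r < card ?X'\<close> by (metis card.empty not_less0)
    moreover have cRA: "card (R \<inter> A) \<le> M"
    proof (rule ccontr)
      assume "\<not> ?thesis"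
      then have "card (R \<inter> A) \<ge> M + 1" by simp
      moreover from this have "(M - 1) * (M + 1) \<le> (M - 1) * card (R \<inter> A)"
        by (rule mult_le_mono2)
      moreover have "(M - 1) * (M + 1) + 1 = M\<^sup>2"
        using M by (cases M) (simp_all add: power2_eq_square)
      ultimately show False
        using bound[OF insertI1] card_R_diff rest'(1) M3 by linarith
    qed
    have max': "card P \<le> Suc (M - 1)" if "P \<in> Q'" for P
      using that
    proof (cases rule: refine_cases)
      case (1 S) then show ?thesis using one M by simp
    next
      case (2 S) then show ?thesis using diff_le[of S] by simp
    qed (use cRA in simp)
    ultimately have "main_phase r Q' (R - A)"
      unfolding main_phase_def using M3 K' sizes' max'
      by (intro exI[of _ "M - 1"] exI[of _ K']) auto
    then show ?thesis using wl by blast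
  qed
qed

lemma main_phase_step:
  assumes "r \<ge> 1" "main_phase r Q R"
  shows "wasteless \<and> main_phase r Q' (R - A) \<or> end_phase r Q' (R - A)"
proof -
  obtain M K where MK: "2 \<le> M" "K \<subseteq> Q" "card K = 3 * r"
    "\<forall>P\<in>K. card P = M \<or> Suc (card P) = M" "{P \<in> K. card P = M} \<noteq> {}"
    "\<forall>P\<in>Q. card P \<le> Suc M"
    "M = r \<and> card {P \<in> K. card P = M} = 3 * r \<or>
      rest_bound r M (card {P \<in> K. card P = M}) (card R)"
    using assms(2) unfolding main_phase_def by blast
  show ?thesis
  proof (cases "\<exists>U\<in>K. card U = M \<and> U \<inter> A = {}")
    case True
    then show ?thesis using main_phase_keep[of M K] MK assms(1) by blast
  next
    case False
    then show ?thesis using main_phase_drop[of M K] MK assms(1) by blast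
  qed
qed

text \<open>An untouched cell prevents a cell of size 2 from being taken whole. If the step is not
  \<open>wasteless\<close>, a singleton was taken, and \<open>chosen_bound\<close> with |V| = 1
  leaves at most one point of every cell.\<close>

lemma end_phase_step:
  assumes r: "r \<ge> 1" and ep: "end_phase r Q R"
  shows "wasteless \<and> end_phase r Q' (R - A) \<or> (\<forall>P\<in>insert (R - A) Q'. card P \<le> 1)"
proof -
  have max: "card P \<le> 2" if "P \<in> insert R Q" for P using ep that by (auto simp: end_phase_def)
  obtain U where U: "U \<in> Q" "U \<inter> A = {}"
    using exists_unchosen[of Q] ep r by (auto simp: end_phase_def)
  have "card U \<ge> 1" using U nonempty fin_cell by (metis Suc_le_eq One_nat_def card_gt_0_iff)
  then have bound: "card (S \<inter> A) \<le> card (S - A) + 1" if "S \<in> insert R Q" for S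
    using unchosen_bound[OF U that] by (metis le_trans mult_le_mono1 mult_1)
  have one: "card (S \<inter> A) \<le> 1" if "S \<in> insert R Q" for S
    using bound[OF that] max[OF that] card_split[OF that] by simp
  show ?thesis
  proof (cases wasteless)
    case True
    have "card P \<le> 2" if "P \<in> Q'" for P
      using that
    proof (cases rule: refine_cases)
      case (1 S) then show ?thesis using one[of S] by (simp add: chosen_def)
    next
      case (2 S) then show ?thesis using max[of S] card_split[of S] by simp
    next
      case 3 then show ?thesis using one[of R] by simp
    qed
    moreover have "card (R - A) \<le> 2" using max[of R] card_R_diff by simp
    ultimately show ?thesis
      using True ep card_refine_mono by (auto simp: end_phase_def)
  next
    case False
    then obtain V where V: "V \<in> Q" "V \<inter> A \<noteq> {}" "\<not> (card (V \<inter> A) = 1 \<and> V - A \<noteq> {})"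
      unfolding wasteless_def by blast
    then have Vc: "V \<in> chosen" by (simp add: chosen_def)
    have "card (V \<inter> A) = 1"
      using one[of V] V fin_cell by (simp add: card_gt_0_iff le_Suc_eq)
    moreover from this have "V - A = {}" using V by blast
    ultimately have VA: "V - A = {}" "card V = 1" using card_split[OF insertI2[OF V(1)]]
      by (simp_all only: card.empty add_0_right)
    have diff: "card (S - A) \<le> 1" if "S \<in> insert R Q" for S
    proof (cases "S = V")
      case True
      then show ?thesis using VA(1) by (metis card.empty le0)
    next
      case False
      then have "card (S - A) \<le> card (S \<inter> A) + 1"
        using chosen_bound[OF Vc that] VA by simp
      then show ?thesis using one[OF that] max[OF that] card_split[OF that] by simp
    qed
    have "card P \<le> 1" if "P \<in> Q'" for P
      using that
    proof (cases rule: refine_cases)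
      case (1 S) then show ?thesis using one[of S] by (simp add: chosen_def)
    next
      case (2 S) then show ?thesis using diff[of S] by simp
    next
      case 3 then show ?thesis using one[of R] by simp
    qed
    then show ?thesis using diff[of R] by simp
  qed
qed

text \<open>Touching a cell of size r would leave at most r - 1 picks for \<open>R\<close>, hence |R
  - A| <= r^2 and |R| < r^2 + r. So \<open>A\<close> lies inside \<open>R\<close>.\<close>

lemma first_phase_step:
  assumes r: "r \<ge> 1" and sizes: "\<And>P. P \<in> Q \<Longrightarrow> card P = r" and large: "card R \<ge> r\<^sup>2 + r"
  shows "Q' = insert A Q" and "card Q' = Suc (card Q)" and "card (R - A) + r = card R"
proof -
  have "chosen = {}"
  proof (rule ccontr)
    assume "chosen \<noteq> {}"
    then obtain V where V: "V \<in> chosen" by blast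
    then have VQ: "V \<in> Q" by (simp add: chosen_def)
    have "card chosen \<ge> 1" using V finite_chosen by (auto simp: Suc_le_eq card_gt_0_iff)
    then have a: "card (R \<inter> A) + 1 \<le> r" using card_chosen by simp
    have "card (R - A) \<le> r * (card (R \<inter> A) + 1)"
      using chosen_bound[OF V, of R] R_notin VQ sizes[OF VQ] by auto
    also have "\<dots> \<le> r * r" using a by (rule mult_le_mono2)
    finally show False using a large card_R_diff by (simp add: power2_eq_square)
  qed
  then have un: "P \<inter> A = {}" "P - A = P" if "P \<in> Q" for P using that by (auto simp: chosen_def)
  have RA: "R \<inter> A = A" using A_sub un by blast
  have "A \<noteq> {}" using card_A r by auto
  show Q': "Q' = insert A Q"
    using un \<open>A \<noteq> {}\<close> nonempty RA unfolding refine_def by auto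
  have "A \<notin> Q" using un \<open>A \<noteq> {}\<close> by blast
  then show "card Q' = Suc (card Q)" using Q' finQ by simp
  show "card (R - A) + r = card R" using card_R_diff RA card_A by simp
qed

end

section \<open>Greedy prefixes and the greedy number\<close>

text \<open>Dropping the stopping condition lets a sequence be extended, so that a bound on all
  prefixes also proves termination.\<close>

definition greedy_prefix :: "'g set \<Rightarrow> ('g \<Rightarrow> 'a \<Rightarrow> 'a) \<Rightarrow> 'a set \<Rightarrow> 'a list \<Rightarrow> bool" where
  "greedy_prefix G act Omega bs \<longleftrightarrow>
     (\<forall>i < length bs.
        \<not> acts_trivially (pw_stab G act (set (take i bs))) act Omega \<and>
        in_largest_orbit (pw_stab G act (set (take i bs))) act Omega (bs ! i))"

text \<open>\<open>Max\<close> is meaningful only on a finite nonempty set. Boundedness gives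
  finiteness; a longest prefix gives a member, since with a nontrivial stabiliser it could be
  extended by a point of a largest orbit.\<close>

lemma greedy_number_attained:
  assumes fin: "finite Omega" and ne: "Omega \<noteq> {}"
    and bounded: "\<And>bs. greedy_prefix G act Omega bs \<Longrightarrow> length bs \<le> N"
  obtains bs where "greedy_prefix G act Omega bs" "greedy_number G act Omega = length bs"
proof -
  let ?pre = "greedy_prefix G act Omega"
  have "?pre []" by (simp add: greedy_prefix_def)
  then obtain bs where bs: "?pre bs" and longest: "\<And>cs. ?pre cs \<Longrightarrow> length cs \<le> length bs"
    using ex_has_greatest_nat[of ?pre "[]" length "Suc N"] bounded by (metis less_Suc_eq_le)
  let ?H = "pw_stab G act (set bs)"
  have triv: "acts_trivially ?H act Omega"
  proof (rule ccontr)
    assume nt: "\<not> acts_trivially ?H act Omega"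
    define f where "f = (\<lambda>x. card (orbit_of ?H act x))"
    have "Max (f ` Omega) \<in> f ` Omega" using fin ne by (intro Max_in) auto
    then obtain x where x: "x \<in> Omega" "f x = Max (f ` Omega)" by (metis imageE)
    have "in_largest_orbit ?H act Omega x"
      using x fin by (auto simp: in_largest_orbit_def f_def[symmetric])
        (metis Max_ge finite_imageI image_eqI f_def)
    then have "?pre (bs @ [x])"
      using bs nt by (auto simp: greedy_prefix_def nth_append less_Suc_eq)
    from longest[OF this] show False by simp
  qed
  let ?L = "{length bs | bs. greedy_seq G act Omega bs}"
  have pre: "greedy_seq G act Omega cs \<Longrightarrow> ?pre cs" for cs
    by (auto simp: greedy_seq_def greedy_prefix_def)
  have "greedy_seq G act Omega bs"
    using bs triv by (simp add: greedy_seq_def greedy_prefix_def)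
  then have "?L \<noteq> {}" by blast
  moreover have "?L \<subseteq> {..N}" using bounded pre by blast
  then have "finite ?L" by (rule finite_subset) simp
  ultimately have "Max ?L \<in> ?L" by (intro Max_in)
  then obtain cs where "greedy_seq G act Omega cs" "Max ?L = length cs" by blast
  then show ?thesis using that[of cs] pre by (simp add: greedy_number_def)
qed

lemma cell_partition_card_le:
  assumes "cell_partition n H Q R"
  shows "card Q \<le> n"
proof -
  note D = cell_partitionD[OF assms]
  have sub: "\<Union>Q \<subseteq> {1..n}" using D(1) by blast
  have fin: "finite P" if "P \<in> Q" for P
    using sub that by (meson Union_upper finite_atLeastAtMost finite_subset)
  have "card Q = (\<Sum>P\<in>Q. 1)" by simp
  also have "\<dots> \<le> (\<Sum>P\<in>Q. card P)"
  proof (rule sum_mono)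
    fix P assume "P \<in> Q"
    then show "1 \<le> card P" using D(3) fin by (metis One_nat_def Suc_le_eq card_gt_0_iff)
  qed
  also have "\<dots> = card (\<Union>Q)" using D(2) fin by (intro card_Union_disjoint[symmetric])
  also have "\<dots> \<le> n" using card_mono[OF _ sub] by simp
  finally show ?thesis .
qed

section \<open>Counting cells along a prefix\<close>

context
  fixes n r :: nat and bs :: "nat set list"
  assumes pre: "greedy_prefix (Sym n) subset_action (r_subsets n r) bs"
begin

lemma prefix_step:
  assumes i: "i < length bs" and cp: "cell_partition n (sym_stab n (set (take i bs))) Q R"
  shows "greedy_step Q R (bs ! i) r"
    and "cell_partition n (sym_stab n (set (take (Suc i) bs))) (refine (bs ! i) Q R) (R - bs ! i)"
proof -
  have large: "in_largest_orbit (sym_stab n (set (take i bs))) subset_action (r_subsets n r) (bs ! i)"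
    using pre i by (simp add: greedy_prefix_def)
  then show "greedy_step Q R (bs ! i) r" by (rule greedy_stepI[OF cp])
  show "cell_partition n (sym_stab n (set (take (Suc i) bs))) (refine (bs ! i) Q R) (R - bs ! i)"
    using cell_partition_refine[OF cp] i by (simp add: take_Suc_conv_app_nth)
qed

lemma prefix_not_discrete:
  assumes "i < length bs" "cell_partition n (sym_stab n (set (take i bs))) Q R"
  shows "\<not> (\<forall>P\<in>insert R Q. card P \<le> 1)"
proof
  assume "\<forall>P\<in>insert R Q. card P \<le> 1"
  then have "acts_trivially (sym_stab n (set (take i bs))) subset_action (r_subsets n r)"
    by (intro cell_partition_trivial[OF assms(2)]) (rule bspec)
  then show False using assms(1) pre by (simp add: greedy_prefix_def)
qed

text \<open>The numerical hypothesis is exactly what \<open>first_phase_step\<close> demands of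
  \<open>R\<close> before the last of the i steps.\<close>

lemma first_phase:
  assumes "r \<ge> 1" "i \<le> length bs" "i * r + r\<^sup>2 \<le> n"
  shows "\<exists>Q R. cell_partition n (sym_stab n (set (take i bs))) Q R \<and>
    (\<forall>P\<in>Q. card P = r) \<and> card Q = i \<and> card R + i * r = n"
  using assms(2,3)
proof (induction i)
  case 0
  show ?case using cell_partition_Nil by (intro exI[of _ "{}"] exI[of _ "{1..n}"]) simp
next
  case (Suc i)
  then obtain Q R where cp: "cell_partition n (sym_stab n (set (take i bs))) Q R"
    and Q: "\<forall>P\<in>Q. card P = r" "card Q = i" and R: "card R + i * r = n"
    by auto
  let ?A = "bs ! i"
  have i: "i < length bs" using Suc.prems by simp
  interpret greedy_step Q R ?A r by (rule prefix_step(1)[OF i cp])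
  have large: "card R \<ge> r\<^sup>2 + r" using R Suc.prems by simp
  have "\<And>P. P \<in> Q \<Longrightarrow> card P = r" using Q by blast
  note first = first_phase_step[OF assms(1) this large]
  have "\<forall>P\<in>Q'. card P = r" using first(1) Q(1) card_A by auto
  moreover have "card Q' = Suc i" using first(2) Q(2) by simp
  moreover have "card (R - ?A) + Suc i * r = n" using first(3) R by simp
  ultimately show ?case using prefix_step(2)[OF i cp] by blast
qed

text \<open>The difference |Q| - |R| never decreases, and it grows by at least r in a
  \<open>wasteless\<close> step. The first 3 r steps each add a cell besides taking r points from
  \<open>R\<close>, which gives the surplus 3 r. Each of the two phase changes costs at most r of
  it.\<close>

lemma later_phases:
  assumes r: "r \<ge> 2" and n: "4 * r\<^sup>2 \<le> n" and len: "3 * r + j \<le> length bs"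
  shows "\<exists>Q R. cell_partition n (sym_stab n (set (take (3 * r + j) bs))) Q R \<and>
    (main_phase r Q R \<and> r * (3 * r + j) + 3 * r + card R \<le> card Q + n \<or>
     end_phase r Q R \<and> r * (3 * r + j) + 2 * r + card R \<le> card Q + n \<or>
     (\<forall>P\<in>insert R Q. card P \<le> 1) \<and> r * (3 * r + j) + r + card R \<le> card Q + n)"
  using len
proof (induction j)
  case 0
  \<comment> \<open>Here the hypothesis n >= 4 r^2 provides room for 3 r disjoint sets.\<close>
  have "3 * r * r + r\<^sup>2 \<le> n" using n by (simp add: power2_eq_square)
  then obtain Q R where cp: "cell_partition n (sym_stab n (set (take (3 * r) bs))) Q R"
    and Q: "\<forall>P\<in>Q. card P = r" "card Q = 3 * r" and R: "card R + 3 * r * r = n"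
    using first_phase[of "3 * r"] r 0 by auto
  have X: "{P \<in> Q. card P = r} = Q" using Q by auto
  have "Q \<noteq> {}" using Q(2) r by auto
  then have "main_phase r Q R"
    unfolding main_phase_def using r Q X by (intro exI[of _ r] exI[of _ Q]) auto
  then show ?case using cp Q R by (intro exI[of _ Q] exI[of _ R]) (simp add: algebra_simps)
next
  case (Suc j)
  let ?i = "3 * r + j"
  from Suc obtain Q R where cp: "cell_partition n (sym_stab n (set (take ?i bs))) Q R"
    and cases: "main_phase r Q R \<and> r * ?i + 3 * r + card R \<le> card Q + n \<or>
     end_phase r Q R \<and> r * ?i + 2 * r + card R \<le> card Q + n \<or>
     (\<forall>P\<in>insert R Q. card P \<le> 1) \<and> r * ?i + r + card R \<le> card Q + n"
    by auto
  let ?A = "bs ! ?i"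
  have i: "?i < length bs" using Suc.prems by simp
  interpret greedy_step Q R ?A r by (rule prefix_step(1)[OF i cp])
  have cp': "cell_partition n (sym_stab n (set (take (3 * r + Suc j) bs))) Q' (R - ?A)"
    using prefix_step(2)[OF i cp] by simp
  have ri: "r * (3 * r + Suc j) = r * ?i + r" by simp
  have mono: "card Q + card (R - ?A) \<le> card Q' + card R"
    using card_refine_mono card_R_diff by simp
  have gain: "card Q + card (R - ?A) + r \<le> card Q' + card R" if wasteless
    using card_refine_wasteless[OF that] card_R_diff by simp
  have r1: "r \<ge> 1" using r by simp
  \<comment> \<open>A discrete partition has trivial stabiliser, so no further point could have been
    chosen.\<close>
  from cases consider (main) "main_phase r Q R" "r * ?i + 3 * r + card R \<le> card Q + n"
    | (final) "end_phase r Q R" "r * ?i + 2 * r + card R \<le> card Q + n"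
    using prefix_not_discrete[OF i cp] by blast
  then show ?case
  proof cases
    case main
    from main_phase_step[OF r1 main(1)] show ?thesis
    proof (elim disjE conjE)
      assume "wasteless" "main_phase r Q' (R - ?A)"
      moreover have "r * (3 * r + Suc j) + 3 * r + card (R - ?A) \<le> card Q' + n"
        using gain[OF \<open>wasteless\<close>] main(2) unfolding ri by linarith
      ultimately show ?thesis using cp' by blast
    next
      assume "end_phase r Q' (R - ?A)"
      moreover have "r * (3 * r + Suc j) + 2 * r + card (R - ?A) \<le> card Q' + n"
        using mono main(2) unfolding ri by linarith
      ultimately show ?thesis using cp' by blast
    qed
  next
    case final
    from end_phase_step[OF r1 final(1)] show ?thesis
    proof (elim disjE conjE)
      assume "wasteless" "end_phase r Q' (R - ?A)"
      moreover have "r * (3 * r + Suc j) + 2 * r + card (R - ?A) \<le> card Q' + n"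
        using gain[OF \<open>wasteless\<close>] final(2) unfolding ri by linarith
      ultimately show ?thesis using cp' by blast
    next
      assume "\<forall>P\<in>insert (R - ?A) Q'. card P \<le> 1"
      moreover have "r * (3 * r + Suc j) + r + card (R - ?A) \<le> card Q' + n"
        using mono final(2) unfolding ri by linarith
      ultimately show ?thesis using cp' by blast
    qed
  qed
qed

lemma prefix_length_le:
  assumes r: "r \<ge> 1" and n: "4 * r\<^sup>2 \<le> n"
  shows "r * length bs \<le> 2 * n"
proof (cases "r = 1")
  case True
  \<comment> \<open>The main phase starts with M = r and requires M >= 2, so r = 1 is separate:
    after n - 1 disjoint singletons only one point is left in \<open>R\<close>.\<close>
  have "length bs \<le> n - 1"
  proof (rule ccontr)
    assume "\<not> ?thesis"
    then have i: "n - 1 < length bs" by simp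
    obtain Q R where cp: "cell_partition n (sym_stab n (set (take (n - 1) bs))) Q R"
      and "\<forall>P\<in>Q. card P = r" "card R + (n - 1) * r = n"
      using first_phase[of "n - 1"] i True n by auto
    then have "\<forall>P\<in>insert R Q. card P \<le> 1" using True n by auto
    then show False using prefix_not_discrete[OF i cp] by simp
  qed
  then show ?thesis using True by simp
next
  case False
  then have r2: "r \<ge> 2" using r by simp
  show ?thesis
  proof (cases "3 * r \<le> length bs")
    case True
    define j where "j = length bs - 3 * r"
    have j: "3 * r + j = length bs" using True by (simp add: j_def)
    obtain Q R where cp: "cell_partition n (sym_stab n (set (take (length bs) bs))) Q R"
      and "r * length bs \<le> card Q + n"
      using later_phases[OF r2 n, of j] unfolding j by fastforce
    then show ?thesis using cell_partition_card_le[OF cp] by simp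
  next
    case False
    \<comment> \<open>Fewer than 3 r sets were chosen, and 3 r^2 <= n.\<close>
    then have "r * length bs \<le> r * (3 * r)" by (intro mult_le_mono2) simp
    then show ?thesis using n unfolding power2_eq_square by linarith
  qed
qed

end

theorem theorem2p8:
  fixes n r :: nat
  assumes "r \<ge> 1" and "n \<ge> 4 * r^2"
  shows "real (greedy_number (Sym n) subset_action (r_subsets n r)) \<le> 2 * real n / real r + 1"
proof -
  have fin: "finite (r_subsets n r)"
    by (rule finite_subset[of _ "Pow {1..n}"]) (auto simp: r_subsets_def)
  have "r \<le> r^2" by (simp add: power2_eq_square)
  then have "r \<le> n" using assms(2) by linarith
  then have ne: "r_subsets n r \<noteq> {}"
    using obtain_subset_with_card_n[of r "{1..n}"] by (auto simp: r_subsets_def)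
  have len: "r * length bs \<le> 2 * n"
    if "greedy_prefix (Sym n) subset_action (r_subsets n r) bs" for bs
    using prefix_length_le[OF that assms(1)] assms(2) by simp
  then have "length bs \<le> 2 * n"
    if "greedy_prefix (Sym n) subset_action (r_subsets n r) bs" for bs
    using len[OF that] assms(1) by (metis le_trans mult_le_mono1 mult_1)
  from greedy_number_attained[OF fin ne this] obtain bs
    where bs: "greedy_prefix (Sym n) subset_action (r_subsets n r) bs"
      "greedy_number (Sym n) subset_action (r_subsets n r) = length bs" by blast
  have "real r * real (length bs) \<le> 2 * real n"
    using len[OF bs(1)] by (metis of_nat_le_iff of_nat_mult of_nat_numeral)
  then have "real (length bs) \<le> 2 * real n / real r"
    using assms(1) by (simp add: pos_le_divide_eq mult.commute)
  then show ?thesis using bs(2) by simp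
qed

end
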